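(* (Duality principle) For any noncrossing partition $\pi$, $$\Lambda(\pi)(X)=(-1)^{|\pi|}\Lambda^s(\pi)(-X).$$
   Context: A noncrossing partition is a partition $\pi$ of a set $[n]=\{1,\ldots,n\}$, $n\ge1$, into nonempty blocks such that there are no distinct blocks $b\ne b'$ and $x,z\in b$, $y,t\in b'$ with $x<y<z<t$. $|\pi|$ is its number of blocks. The nesting order on the set of blocks of $\pi$ is the partial order $b\le_\pi b'\iff b'\subseteq[\min b,\max b]$. Let $\mathbb{K}$ be a field of characteristic zero. $\Lambda(\pi)\in\mathbb{K}[X]$ is the unique polynomial such that, for all integers $N\ge1$, $\Lambda(\pi)(N)$ is the number of maps $f$ from the set of blocks of $\pi$ to $[N]$ with $b\le_\pi b'\Rightarrow f(b)\le f(b')$. $\Lambda^s(\pi)\in\mathbb{K}[X]$ is the unique polynomial such that, for all $N\ge1$, $\Lambda^s(\pi)(N)$ is the number of maps $f$ from the set of blocks of $\pi$ to $[N]$ with ($b\le_\pi b'$ and $b\ne b'$) $\Rightarrow f(b)<f(b')$. *)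

theory Defs
  imports
    Complex_Main
    "HOL-Library.Disjoint_Sets"
    "HOL-Library.FuncSet"
    "HOL-Computational_Algebra.Polynomial"
begin

definition noncrossing_partition :: "nat \<Rightarrow> nat set set \<Rightarrow> bool" where
  "noncrossing_partition n \<pi> \<longleftrightarrow>
     n \<ge> 1 \<and> partition_on {1..n} \<pi> \<and>
     \<not> (\<exists>b\<in>\<pi>. \<exists>b'\<in>\<pi>. b \<noteq> b' \<and>
          (\<exists>x\<in>b. \<exists>z\<in>b. \<exists>y\<in>b'. \<exists>t\<in>b'. x < y \<and> y < z \<and> z < t))"

definition nesting_le :: "nat set set \<Rightarrow> nat set \<Rightarrow> nat set \<Rightarrow> bool" where
  "nesting_le \<pi> b b' \<longleftrightarrow> b \<in> \<pi> \<and> b' \<in> \<pi> \<and> b' \<subseteq> {Min b..Max b}"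

text \<open>Labelings are taken in the extensional function space, so that they correspond
  one-to-one to maps defined on the blocks only and can be counted.\<close>

definition weak_labelings :: "nat set set \<Rightarrow> nat \<Rightarrow> (nat set \<Rightarrow> nat) set" where
  "weak_labelings \<pi> N =
     {f \<in> \<pi> \<rightarrow>\<^sub>E {1..N}. \<forall>b\<in>\<pi>. \<forall>b'\<in>\<pi>. nesting_le \<pi> b b' \<longrightarrow> f b \<le> f b'}"

definition strict_labelings :: "nat set set \<Rightarrow> nat \<Rightarrow> (nat set \<Rightarrow> nat) set" where
  "strict_labelings \<pi> N =
     {f \<in> \<pi> \<rightarrow>\<^sub>E {1..N}. \<forall>b\<in>\<pi>. \<forall>b'\<in>\<pi>. nesting_le \<pi> b b' \<and> b \<noteq> b' \<longrightarrow> f b < f b'}"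

definition Lambda :: "nat set set \<Rightarrow> 'k :: field_char_0 poly" where
  "Lambda \<pi> =
     (THE p. \<forall>N::nat. N \<ge> 1 \<longrightarrow> poly p (of_nat N) = of_nat (card (weak_labelings \<pi> N)))"

definition Lambda_s :: "nat set set \<Rightarrow> 'k :: field_char_0 poly" where
  "Lambda_s \<pi> =
     (THE p. \<forall>N::nat. N \<ge> 1 \<longrightarrow> poly p (of_nat N) = of_nat (card (strict_labelings \<pi> N)))"

end

theory Submission
  imports Defs
begin

text \<open>
  The statement is an instance of Stanley's reciprocity between the two order polynomials of a
  finite poset. For nesting posets it has a short inductive proof, because noncrossingness makes
  them rooted forests: two blocks whose intervals both contain a third block are themselves nested
  (\<open>noncrossing_nesting_chain\<close>).

  A forest is empty, or a disjoint union of two smaller forests, or a root below a smaller forest.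
  Disjoint unions multiply both counts (\<open>card_gap_labelings_disjoint_sum\<close>). Adding a root, and
  summing over its label, replaces a weak count \<open>w\<close> by \<open>w(1) + \<dots> + w(N)\<close> and a strict count \<open>s\<close> by
  \<open>s(0) + \<dots> + s(N - 1)\<close> (\<open>card_gap_labelings_add_root\<close>). Multiplication clearly respects the
  relation \<open>w(X) = (-1)\<^sup>m s(-X)\<close>. So does adding a root: the new strict polynomial \<open>S\<close> is the
  antidifference of \<open>s\<close>, that is \<open>S(X + 1) - S(X) = s(X)\<close> and \<open>S(0) = 0\<close>, and running this recursion
  from \<open>0\<close> through the negative integers shows that \<open>(-1)\<^bsup>m + 1\<^esup> S(-N)\<close> is
  \<open>w(1) + \<dots> + w(N)\<close> (\<open>forest_reciprocity\<close>). As a polynomial over a field of characteristic zero is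
  determined by its values at the positive integers, the polynomials so obtained are the two given
  by definite description.
\<close>

section \<open>Polynomial antidifferences\<close>

text \<open>
  Since \<open>(x + 1)\<^bsup>n + 1\<^esup> - x\<^bsup>n + 1\<^esup>\<close> is \<open>(n + 1) x\<^sup>n\<close> plus lower powers, one can solve for \<open>x\<^sup>n\<close>
  recursively; this is where characteristic zero is used.
\<close>

lemma power_antidifference:
  "\<exists>s :: 'k :: field_char_0 poly. poly s 0 = 0 \<and> (\<forall>x. poly s (x + 1) - poly s x = x ^ n)"
proof (induction n rule: less_induct)
  case (less n)
  then obtain t :: "nat \<Rightarrow> 'k poly" where
    t: "\<And>k. k < n \<Longrightarrow> poly (t k) 0 = 0 \<and> (\<forall>x. poly (t k) (x + 1) - poly (t k) x = x ^ k)"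
    by metis
  define c :: "nat \<Rightarrow> 'k" where "c k = of_nat (Suc n choose k)" for k
  define s where
    "s = smult (1 / of_nat (Suc n)) (monom 1 (Suc n) - (\<Sum>k<n. smult (c k) (t k)))"
  have s0: "poly s 0 = 0"
    using t by (simp add: s_def poly_sum poly_monom)
  have "poly s (x + 1) - poly s x = x ^ n" for x
  proof -
    have "(x + 1) ^ Suc n = (\<Sum>k\<le>Suc n. c k * x ^ k)"
      by (simp only: binomial_ring c_def) simp
    also have "\<dots> = (\<Sum>k<n. c k * x ^ k) + of_nat (Suc n) * x ^ n + x ^ Suc n"
      by (simp add: c_def lessThan_Suc_atMost [symmetric])
    finally have binom:
      "(x + 1) ^ Suc n - x ^ Suc n - (\<Sum>k<n. c k * x ^ k) = of_nat (Suc n) * x ^ n"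
      by simp
    have lower: "(\<Sum>k<n. c k * poly (t k) (x + 1)) - (\<Sum>k<n. c k * poly (t k) x)
        = (\<Sum>k<n. c k * x ^ k)"
      using t by (simp add: sum_subtractf [symmetric] right_diff_distrib [symmetric])
    have "poly s (x + 1) - poly s x =
        ((x + 1) ^ Suc n - x ^ Suc n - ((\<Sum>k<n. c k * poly (t k) (x + 1)) -
          (\<Sum>k<n. c k * poly (t k) x))) / of_nat (Suc n)"
      unfolding s_def poly_smult poly_diff poly_sum poly_monom
      by (simp only: diff_divide_distrib) (simp add: diff_divide_distrib del: power_Suc of_nat_Suc)
    also have "\<dots> = x ^ n"
      unfolding lower binom by (simp del: of_nat_Suc)
    finally show ?thesis .
  qed
  with s0 show ?case by blast
qed

lemma poly_antidifference:
  fixes q :: "'k :: field_char_0 poly"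
  obtains s where "poly s 0 = 0" "\<And>x. poly s (x + 1) - poly s x = poly q x"
proof -
  obtain t :: "nat \<Rightarrow> 'k poly" where
    t: "\<And>k. poly (t k) 0 = 0 \<and> (\<forall>x. poly (t k) (x + 1) - poly (t k) x = x ^ k)"
    using power_antidifference by metis
  define s where "s = (\<Sum>k\<le>degree q. smult (coeff q k) (t k))"
  have "poly s 0 = 0"
    using t by (simp add: s_def poly_sum)
  moreover have "poly s (x + 1) - poly s x = poly q x" for x
    using t by (simp add: s_def poly_sum poly_altdef [of q] sum_subtractf [symmetric]
        right_diff_distrib [symmetric])
  ultimately show ?thesis by (rule that)
qed

lemma antidifference_of_nat:
  fixes s q :: "'k :: field_char_0 poly"
  assumes "poly s 0 = 0" and step: "\<And>x. poly s (x + 1) - poly s x = poly q x"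
  shows "poly s (of_nat N) = (\<Sum>i<N. poly q (of_nat i))"
proof (induction N)
  case (Suc N)
  then show ?case using step [of "of_nat N"] by (simp add: algebra_simps)
qed (use assms in simp)

text \<open>
  Below zero the recursion subtracts, which yields one extra sign, and it meets the arguments
  \<open>-1, \<dots>, -N\<close> in place of \<open>0, \<dots>, N - 1\<close>. These are exactly the two changes that turn the strict
  recursion at a root into the weak one.
\<close>

lemma antidifference_uminus_of_nat:
  fixes s q :: "'k :: field_char_0 poly"
  assumes "poly s 0 = 0" and step: "\<And>x. poly s (x + 1) - poly s x = poly q x"
  shows "poly s (- of_nat N) = - (\<Sum>i<N. poly q (- of_nat (Suc i)))"
proof (induction N)
  case (Suc N)
  then show ?case using step [of "- of_nat (Suc N)"] by (simp add: algebra_simps)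
qed (use assms in simp)

lemma poly_eqI_positive_nats:
  fixes p q :: "'k :: field_char_0 poly"
  assumes "\<And>N. N \<ge> 1 \<Longrightarrow> poly p (of_nat N) = poly q (of_nat N)"
  shows "p = q"
proof (rule ccontr)
  assume "p \<noteq> q"
  then have "finite {x. poly (p - q) x = 0}"
    by (intro poly_roots_finite) simp
  moreover have "of_nat ` {1::nat..} \<subseteq> {x. poly (p - q) x = 0}"
    using assms by auto
  ultimately have "finite ((of_nat :: nat \<Rightarrow> 'k) ` {1..})"
    by (rule rev_finite_subset)
  then have "finite {1::nat..}"
    by (rule finite_imageD) (simp add: inj_on_def)
  then show False by (simp add: infinite_Ici)
qed

section \<open>Labelings of a poset with prescribed gaps\<close>

text \<open>
  With \<open>d = 0\<close> these are the weakly increasing labelings and with \<open>d = 1\<close> the strictly increasing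
  ones, so that both recursions are proved at once. Here \<open>lt\<close> is the strict order.
\<close>

definition gap_labelings :: "('a \<Rightarrow> 'a \<Rightarrow> bool) \<Rightarrow> nat \<Rightarrow> 'a set \<Rightarrow> nat \<Rightarrow> ('a \<Rightarrow> nat) set" where
  "gap_labelings lt d A N =
     {f \<in> A \<rightarrow>\<^sub>E {1..N}. \<forall>x\<in>A. \<forall>y\<in>A. lt x y \<longrightarrow> f x + d \<le> f y}"

lemma gap_labelings_extensional: "f \<in> gap_labelings lt d A N \<Longrightarrow> f \<in> extensional A"
  by (auto simp: gap_labelings_def PiE_def)

lemma gap_labelings_range: "f \<in> gap_labelings lt d A N \<Longrightarrow> x \<in> A \<Longrightarrow> 1 \<le> f x \<and> f x \<le> N"
  by (auto simp: gap_labelings_def PiE_def Pi_def)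

lemma gap_labelings_gap:
  "f \<in> gap_labelings lt d A N \<Longrightarrow> x \<in> A \<Longrightarrow> y \<in> A \<Longrightarrow> lt x y \<Longrightarrow> f x + d \<le> f y"
  by (auto simp: gap_labelings_def)

lemma gap_labelingsI:
  assumes "f \<in> extensional A" "\<And>x. x \<in> A \<Longrightarrow> 1 \<le> f x \<and> f x \<le> N"
    "\<And>x y. x \<in> A \<Longrightarrow> y \<in> A \<Longrightarrow> lt x y \<Longrightarrow> f x + d \<le> f y"
  shows "f \<in> gap_labelings lt d A N"
  using assms by (auto simp: gap_labelings_def PiE_def Pi_def)

lemma finite_gap_labelings: "finite A \<Longrightarrow> finite (gap_labelings lt d A N)"
  unfolding gap_labelings_def by (rule finite_subset [OF _ finite_PiE [of A "\<lambda>_. {1..N}"]]) auto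

lemma card_gap_labelings_empty: "card (gap_labelings lt d {} N) = 1"
  by (simp add: gap_labelings_def)

lemma card_gap_labelings_disjoint_sum:
  assumes disj: "A \<inter> B = {}"
    and incomparable: "\<And>x y. x \<in> A \<Longrightarrow> y \<in> B \<Longrightarrow> \<not> lt x y \<and> \<not> lt y x"
  shows "card (gap_labelings lt d (A \<union> B) N) =
    card (gap_labelings lt d A N) * card (gap_labelings lt d B N)"
proof -
  have "bij_betw (\<lambda>f. (restrict f A, restrict f B)) (gap_labelings lt d (A \<union> B) N)
      (gap_labelings lt d A N \<times> gap_labelings lt d B N)"
  proof (rule bij_betw_byWitness
      [where f' = "\<lambda>(g, h). restrict (\<lambda>x. if x \<in> A then g x else h x) (A \<union> B)"])
    show "\<forall>f\<in>gap_labelings lt d (A \<union> B) N.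
        (case (restrict f A, restrict f B) of
          (g, h) \<Rightarrow> restrict (\<lambda>x. if x \<in> A then g x else h x) (A \<union> B)) = f"
      by (auto simp: fun_eq_iff restrict_def extensional_def dest!: gap_labelings_extensional)
    show "\<forall>p\<in>gap_labelings lt d A N \<times> gap_labelings lt d B N.
        (\<lambda>f. (restrict f A, restrict f B))
          (case p of (g, h) \<Rightarrow> restrict (\<lambda>x. if x \<in> A then g x else h x) (A \<union> B)) = p"
      using disj
      by (force simp: fun_eq_iff restrict_def extensional_def dest!: gap_labelings_extensional)
    show "(\<lambda>f. (restrict f A, restrict f B)) ` gap_labelings lt d (A \<union> B) N
        \<subseteq> gap_labelings lt d A N \<times> gap_labelings lt d B N"
      by (auto intro!: gap_labelingsI simp: gap_labelings_gap dest: gap_labelings_range)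
    show "(\<lambda>(g, h). restrict (\<lambda>x. if x \<in> A then g x else h x) (A \<union> B))
        ` (gap_labelings lt d A N \<times> gap_labelings lt d B N) \<subseteq> gap_labelings lt d (A \<union> B) N"
    proof
      fix f assume "f \<in> (\<lambda>(g, h). restrict (\<lambda>x. if x \<in> A then g x else h x) (A \<union> B))
        ` (gap_labelings lt d A N \<times> gap_labelings lt d B N)"
      then obtain g h where g: "g \<in> gap_labelings lt d A N" and h: "h \<in> gap_labelings lt d B N"
        and f: "f = restrict (\<lambda>x. if x \<in> A then g x else h x) (A \<union> B)" by auto
      show "f \<in> gap_labelings lt d (A \<union> B) N"
      proof (rule gap_labelingsI)
        fix x assume "x \<in> A \<union> B"
        then show "1 \<le> f x \<and> f x \<le> N"
          using gap_labelings_range [OF g, of x] gap_labelings_range [OF h, of x]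
          by (auto simp: f)
      next
        fix x y assume "x \<in> A \<union> B" "y \<in> A \<union> B" "lt x y"
        then show "f x + d \<le> f y"
          using gap_labelings_gap [OF g, of x y] gap_labelings_gap [OF h, of x y]
            incomparable [of x y] incomparable [of y x]
          by (auto simp: f)
      qed (simp add: f)
    qed
  qed
  then show ?thesis
    by (simp add: bij_betw_same_card card_cartesian_product)
qed

text \<open>
  If the root gets the label \<open>N - i\<close>, the other labels range over \<open>{N - i + d..N}\<close>, the last
  \<open>i + 1 - d\<close> elements of \<open>{1..N}\<close>, and can be shifted down to \<open>{1..i + 1 - d}\<close>. For \<open>d = 0\<close> the
  sum runs over the counts for \<open>1, \<dots>, N\<close>, for \<open>d = 1\<close> over those for \<open>0, \<dots>, N - 1\<close>.
\<close>

lemma card_gap_labelings_add_root: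
  assumes "finite A" and "r \<in> A" and root: "\<And>x. x \<in> A \<Longrightarrow> x \<noteq> r \<Longrightarrow> lt r x \<and> \<not> lt x r"
    and "\<not> lt r r"
  shows "card (gap_labelings lt d A N) =
    (\<Sum>i<N. card (gap_labelings lt d (A - {r}) (Suc i - d)))"
proof -
  let ?shift = "\<lambda>i. N - i + d - 1"
  let ?down = "\<lambda>f. (N - f r, \<lambda>x\<in>A - {r}. f x - ?shift (N - f r))"
  let ?up = "\<lambda>(i, g). \<lambda>x\<in>A. if x = r then N - i else g x + ?shift i"
  let ?pairs = "SIGMA i:{..<N}. gap_labelings lt d (A - {r}) (Suc i - d)"
  have "bij_betw ?down (gap_labelings lt d A N) ?pairs"
  proof (rule bij_betw_byWitness [where f' = ?up])
    have bounds: "1 \<le> f r \<and> f r \<le> N \<and> f r + d \<le> f x \<and> f x \<le> N"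
      if "f \<in> gap_labelings lt d A N" "x \<in> A" "x \<noteq> r" for f x
      using that \<open>r \<in> A\<close> root gap_labelings_range gap_labelings_gap by metis
    show "\<forall>f\<in>gap_labelings lt d A N. ?up (?down f) = f"
    proof
      fix f assume f: "f \<in> gap_labelings lt d A N"
      have "?up (?down f) x = f x" for x
      proof (cases "x \<in> A")
        case False
        then show ?thesis using gap_labelings_extensional [OF f] by (simp add: extensional_def)
      next
        case True
        then show ?thesis
          using gap_labelings_range [OF f \<open>r \<in> A\<close>] bounds [OF f True] by auto
      qed
      then show "?up (?down f) = f" by blast
    qed
    show "\<forall>p\<in>?pairs. ?down (?up p) = p"
      using \<open>r \<in> A\<close>
      by (force simp: fun_eq_iff extensional_def dest!: gap_labelings_extensional)
    show "?down ` gap_labelings lt d A N \<subseteq> ?pairs"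
    proof
      fix p assume "p \<in> ?down ` gap_labelings lt d A N"
      then obtain f where f: "f \<in> gap_labelings lt d A N" and p: "p = ?down f" by blast
      have "snd p \<in> gap_labelings lt d (A - {r}) (Suc (N - f r) - d)"
      proof (rule gap_labelingsI)
        fix x assume "x \<in> A - {r}"
        then show "1 \<le> snd p x \<and> snd p x \<le> Suc (N - f r) - d"
          using bounds [OF f, of x] by (auto simp: p)
      next
        fix x y assume "x \<in> A - {r}" "y \<in> A - {r}" "lt x y"
        then show "snd p x + d \<le> snd p y"
          using bounds [OF f, of x] bounds [OF f, of y] gap_labelings_gap [OF f, of x y]
          by (auto simp: p)
      qed (simp add: p)
      then show "p \<in> ?pairs"
        using gap_labelings_range [OF f \<open>r \<in> A\<close>] by (auto simp: p)
    qed
    show "?up ` ?pairs \<subseteq> gap_labelings lt d A N"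
    proof
      fix h assume "h \<in> ?up ` ?pairs"
      then obtain i g where i: "i < N" and g: "g \<in> gap_labelings lt d (A - {r}) (Suc i - d)"
        and h: "h = ?up (i, g)" by auto
      show "h \<in> gap_labelings lt d A N"
      proof (rule gap_labelingsI)
        fix x assume "x \<in> A"
        then show "1 \<le> h x \<and> h x \<le> N"
          using i gap_labelings_range [OF g, of x] by (auto simp: h)
      next
        fix x y assume "x \<in> A" "y \<in> A" "lt x y"
        moreover from this have "y \<noteq> r" using root \<open>\<not> lt r r\<close> by blast
        ultimately show "h x + d \<le> h y"
          using i gap_labelings_range [OF g, of y] gap_labelings_gap [OF g, of x y]
          by (auto simp: h)
      qed (simp add: h)
    qed
  qed
  then have "card (gap_labelings lt d A N) = card ?pairs"
    by (rule bij_betw_same_card)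
  then show ?thesis
    using \<open>finite A\<close> by (simp add: finite_gap_labelings)
qed

section \<open>Reciprocity for forests\<close>

locale finite_forest =
  fixes lt :: "'a \<Rightarrow> 'a \<Rightarrow> bool" and V :: "'a set"
  assumes finite_V: "finite V"
    and irrefl: "x \<in> V \<Longrightarrow> \<not> lt x x"
    and trans: "x \<in> V \<Longrightarrow> y \<in> V \<Longrightarrow> z \<in> V \<Longrightarrow> lt x y \<Longrightarrow> lt y z \<Longrightarrow> lt x z"
    and chain: "x \<in> V \<Longrightarrow> y \<in> V \<Longrightarrow> z \<in> V \<Longrightarrow> lt x z \<Longrightarrow> lt y z \<Longrightarrow> lt x y \<or> x = y \<or> lt y x"
begin

lemma has_minimal:
  assumes "A \<subseteq> V" "A \<noteq> {}"
  obtains r where "r \<in> A" "\<And>x. x \<in> A \<Longrightarrow> \<not> lt x r"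
proof -
  have "asymp_on A lt"
  proof (rule asymp_onI)
    fix x y assume "x \<in> A" "y \<in> A" "lt x y"
    then show "\<not> lt y x" using assms(1) irrefl [of x] trans [of x y x] by blast
  qed
  moreover have "transp_on A lt"
  proof (rule transp_onI)
    fix x y z assume "x \<in> A" "y \<in> A" "z \<in> A" "lt x y" "lt y z"
    then show "lt x z" using assms(1) trans [of x y z] by blast
  qed
  moreover have "finite A" using assms(1) finite_V by (rule finite_subset)
  ultimately obtain r where "r \<in> A" "\<forall>x\<in>A. x \<noteq> r \<longrightarrow> \<not> lt x r"
    using Finite_Set.bex_min_element [of A lt] assms(2) by blast
  moreover from this have "\<not> lt r r" using irrefl assms(1) by blast
  ultimately show thesis by (intro that [of r]) auto
qed

text \<open>
  The tree above a minimal element \<open>r\<close> is incomparable with the rest: an element of the rest lying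
  below some member of the tree would, by the chain property, be comparable with \<open>r\<close>.
\<close>

theorem forest_reciprocity:
  assumes "A \<subseteq> V"
  shows "\<exists>s :: 'k :: field_char_0 poly. \<forall>N.
    poly s (of_nat N) = of_nat (card (gap_labelings lt 1 A N)) \<and>
    (-1) ^ card A * poly s (- of_nat N) = of_nat (card (gap_labelings lt 0 A N))"
  using assms
proof (induction "card A" arbitrary: A rule: less_induct)
  case less
  have fin: "finite A" using less.prems finite_V finite_subset by blast
  show ?case
  proof (cases "A = {}")
    case True
    then show ?thesis by (intro exI [of _ 1]) (simp add: card_gap_labelings_empty)
  next
    case False
    with less.prems obtain r where r: "r \<in> A" and minimal: "\<And>x. x \<in> A \<Longrightarrow> \<not> lt x r"
      using has_minimal by metis
    define B where "B = {x \<in> A. x = r \<or> lt r x}"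
    show ?thesis
    proof (cases "B = A")
      case True
      have "card (A - {r}) < card A"
        using fin r by (rule card_Diff1_less)
      then obtain q :: "'k poly" where
        q: "\<And>N. poly q (of_nat N) = of_nat (card (gap_labelings lt 1 (A - {r}) N))"
        and q_neg: "\<And>N. (-1) ^ card (A - {r}) * poly q (- of_nat N) =
          of_nat (card (gap_labelings lt 0 (A - {r}) N))"
        using less.hyps [of "A - {r}"] less.prems by auto
      obtain s where s0: "poly s 0 = 0" and s: "\<And>x. poly s (x + 1) - poly s x = poly q x"
        using poly_antidifference [of q] by blast
      have root: "card (gap_labelings lt d A N) =
          (\<Sum>i<N. card (gap_labelings lt d (A - {r}) (Suc i - d)))" for d N
        using fin r minimal True
        by (intro card_gap_labelings_add_root) (auto simp: B_def)
      have sign: "(-1) ^ card A = - ((-1) ^ card (A - {r}) :: 'k)"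
        by (simp add: card.remove [OF fin r])
      have "poly s (of_nat N) = of_nat (card (gap_labelings lt 1 A N))" for N
        unfolding antidifference_of_nat [OF s0 s] root [of 1] q by simp
      moreover have "(-1) ^ card A * poly s (- of_nat N) =
          of_nat (card (gap_labelings lt 0 A N))" for N
        unfolding antidifference_uminus_of_nat [OF s0 s] sign root [of 0] of_nat_sum
          q_neg [symmetric]
        by (simp add: sum_distrib_left sum_negf)
      ultimately show ?thesis by blast
    next
      case False
      define C where "C = A - B"
      have "B \<subseteq> A" by (auto simp: B_def)
      then have split: "B \<inter> C = {}" "A = B \<union> C" and "finite B" "finite C"
        using fin by (auto simp: C_def intro: finite_subset)
      then have card_split: "card A = card B + card C"
        by (simp add: card_Un_disjoint)
      have "r \<in> B" using r by (simp add: B_def)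
      moreover have "C \<noteq> {}" using False \<open>B \<subseteq> A\<close> by (simp add: C_def)
      ultimately have "card B > 0" "card C > 0"
        using \<open>finite B\<close> \<open>finite C\<close> by (auto simp: card_gt_0_iff)
      then have smaller: "card B < card A" "card C < card A"
        by (simp_all add: card_split)
      have incomparable: "\<not> lt x y \<and> \<not> lt y x" if "x \<in> B" "y \<in> C" for x y
      proof -
        have V: "x \<in> V" "y \<in> V" "r \<in> V"
          using that less.prems r by (auto simp: B_def C_def)
        have y: "y \<in> A" "y \<noteq> r" "\<not> lt r y" using that by (auto simp: B_def C_def)
        have "r = x \<or> lt r x" using that(1) by (auto simp: B_def)
        then show ?thesis
          using y minimal [of y] trans [of r x y] chain [of r y x] V by blast
      qed
      have product: "card (gap_labelings lt d A N) =
          card (gap_labelings lt d B N) * card (gap_labelings lt d C N)" for d N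
        unfolding split(2) using split(1) incomparable
        by (rule card_gap_labelings_disjoint_sum)
      obtain s where s: "\<And>N. poly s (of_nat N :: 'k) = of_nat (card (gap_labelings lt 1 B N)) \<and>
          (-1) ^ card B * poly s (- of_nat N) = of_nat (card (gap_labelings lt 0 B N))"
        using less.hyps [OF smaller(1)] less.prems by (auto simp: B_def)
      obtain t where t: "\<And>N. poly t (of_nat N :: 'k) = of_nat (card (gap_labelings lt 1 C N)) \<and>
          (-1) ^ card C * poly t (- of_nat N) = of_nat (card (gap_labelings lt 0 C N))"
        using less.hyps [OF smaller(2)] less.prems by (auto simp: C_def)
      have "poly (s * t) (of_nat N) = of_nat (card (gap_labelings lt 1 A N))" for N
        using s t by (simp add: product)
      moreover have "(-1) ^ card A * poly (s * t) (- of_nat N) =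
          of_nat (card (gap_labelings lt 0 A N))" for N
      proof -
        have "(-1) ^ card A * poly (s * t) (- of_nat N) =
            ((-1) ^ card B * poly s (- of_nat N)) * ((-1) ^ card C * poly t (- of_nat N))"
          by (simp add: card_split power_add)
        then show ?thesis using s t by (simp add: product)
      qed
      ultimately show ?thesis by blast
    qed
  qed
qed

end

section \<open>The nesting forest of a noncrossing partition\<close>

definition nesting_less :: "nat set set \<Rightarrow> nat set \<Rightarrow> nat set \<Rightarrow> bool" where
  "nesting_less \<pi> b b' \<longleftrightarrow> nesting_le \<pi> b b' \<and> b \<noteq> b'"

context
  fixes n :: nat and \<pi> :: "nat set set"
  assumes noncrossing: "noncrossing_partition n \<pi>"
begin

lemma blocks_partition: "partition_on {1..n} \<pi>"
  using noncrossing by (simp add: noncrossing_partition_def)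

lemma no_crossing:
  assumes "b \<in> \<pi>" "c \<in> \<pi>" "b \<noteq> c" "x \<in> b" "y \<in> c" "z \<in> b" "t \<in> c"
  shows "\<not> (x < y \<and> y < z \<and> z < t)"
proof
  assume "x < y \<and> y < z \<and> z < t"
  with assms have "\<exists>b\<in>\<pi>. \<exists>b'\<in>\<pi>. b \<noteq> b' \<and>
      (\<exists>x\<in>b. \<exists>z\<in>b. \<exists>y\<in>b'. \<exists>t\<in>b'. x < y \<and> y < z \<and> z < t)"
    by metis
  with noncrossing show False
    by (simp only: noncrossing_partition_def) simp
qed

lemma finite_block:
  assumes "b \<in> \<pi>"
  shows "finite b"
proof -
  have "b \<subseteq> {1..n}" using partition_onD1 [OF blocks_partition] assms by blast
  then show ?thesis by (rule finite_subset) simp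
qed

lemma block_nonempty: "b \<in> \<pi> \<Longrightarrow> b \<noteq> {}"
  using blocks_partition by (auto dest: partition_onD3)

lemma block_eqI: "b \<in> \<pi> \<Longrightarrow> c \<in> \<pi> \<Longrightarrow> x \<in> b \<Longrightarrow> x \<in> c \<Longrightarrow> b = c"
  using disjointD [OF partition_onD2 [OF blocks_partition], of b c] by blast

lemma nesting_le_iff:
  "nesting_le \<pi> b c \<longleftrightarrow> b \<in> \<pi> \<and> c \<in> \<pi> \<and> Min b \<le> Min c \<and> Max c \<le> Max b"
proof (cases "c \<in> \<pi>")
  case True
  then have "c \<subseteq> {Min b..Max b} \<longleftrightarrow> Min b \<le> Min c \<and> Max c \<le> Max b"
    using finite_block [OF True] block_nonempty [OF True] by auto
  then show ?thesis by (auto simp: nesting_le_def)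
qed (simp add: nesting_le_def)

lemma Min_eq_imp_eq: "b \<in> \<pi> \<Longrightarrow> c \<in> \<pi> \<Longrightarrow> Min b = Min c \<Longrightarrow> b = c"
  using block_eqI [of b c "Min b"] Min_in [of b] Min_in [of c] finite_block block_nonempty
  by simp

text \<open>
  Let both intervals contain \<open>d\<close>, with \<open>Min b < Min c\<close>. Then \<open>Min c\<close> lies left of \<open>d\<close> and hence
  strictly inside the interval of \<open>b\<close>; if \<open>c\<close> reached beyond \<open>Max b\<close>, the four points
  \<open>Min b < Min c < Max b < Max c\<close> would be a crossing.
\<close>

lemma noncrossing_nesting_chain:
  assumes "nesting_less \<pi> b d" "nesting_less \<pi> c d"
  shows "nesting_less \<pi> b c \<or> b = c \<or> nesting_less \<pi> c b"
proof -
  have *: "nesting_less \<pi> b c"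
    if bd: "nesting_less \<pi> b d" and cd: "nesting_less \<pi> c d" and less: "Min b < Min c" for b c
  proof -
    have blocks: "b \<in> \<pi>" "c \<in> \<pi>" "d \<in> \<pi>"
      using bd cd by (auto simp: nesting_less_def nesting_le_iff)
    have Min_Max_in: "Min b \<in> b" "Max b \<in> b" "Min c \<in> c" "Max c \<in> c" "Min d \<in> d" "Max d \<in> d"
      using blocks finite_block block_nonempty by auto
    have "b \<noteq> c" using less by auto
    have "Min d \<le> Max d"
      using Min_le [OF finite_block] blocks Min_Max_in by blast
    then have "Min c \<le> Max b"
      using bd cd unfolding nesting_less_def nesting_le_iff by linarith
    moreover have "Min c \<noteq> Max b"
      using block_eqI [OF blocks(1,2), of "Max b"] Min_Max_in \<open>b \<noteq> c\<close> by auto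
    ultimately have "Min c < Max b" by simp
    then have "\<not> Max b < Max c"
      using no_crossing [of b c "Min b" "Min c" "Max b" "Max c"] blocks Min_Max_in less \<open>b \<noteq> c\<close>
      by auto
    then show ?thesis
      using blocks less \<open>b \<noteq> c\<close> by (auto simp: nesting_less_def nesting_le_iff)
  qed
  have "b \<in> \<pi>" "c \<in> \<pi>" using assms by (auto simp: nesting_less_def nesting_le_def)
  then show ?thesis
    using *[of b c] *[of c b] assms Min_eq_imp_eq [of b c]
    by (cases "Min b" "Min c" rule: linorder_cases) auto
qed

lemma nesting_forest: "finite_forest (nesting_less \<pi>) \<pi>"
proof
  show "finite \<pi>"
    by (rule finite_elements [OF _ blocks_partition]) simp
next
  fix b c d
  assume "nesting_less \<pi> b c" "nesting_less \<pi> c d"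
  then show "nesting_less \<pi> b d"
    using Min_eq_imp_eq [of b c] by (auto simp: nesting_less_def nesting_le_iff)
next
  fix b c d
  assume "nesting_less \<pi> b d" "nesting_less \<pi> c d"
  then show "nesting_less \<pi> b c \<or> b = c \<or> nesting_less \<pi> c b"
    by (rule noncrossing_nesting_chain)
qed (simp add: nesting_less_def)

end

lemma weak_labelings_eq_gap_labelings:
  "weak_labelings \<pi> N = gap_labelings (nesting_less \<pi>) 0 \<pi> N"
  by (auto simp: weak_labelings_def gap_labelings_def nesting_less_def)

lemma strict_labelings_eq_gap_labelings:
  "strict_labelings \<pi> N = gap_labelings (nesting_less \<pi>) 1 \<pi> N"
  by (auto simp: strict_labelings_def gap_labelings_def nesting_less_def Suc_le_eq)

lemma Lambda_eqI:
  fixes p :: "'k :: field_char_0 poly"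
  assumes "\<And>N. N \<ge> 1 \<Longrightarrow> poly p (of_nat N) = of_nat (card (weak_labelings \<pi> N))"
  shows "Lambda \<pi> = p"
  unfolding Lambda_def using assms
  by (intro the_equality) (auto intro: poly_eqI_positive_nats)

lemma Lambda_s_eqI:
  fixes p :: "'k :: field_char_0 poly"
  assumes "\<And>N. N \<ge> 1 \<Longrightarrow> poly p (of_nat N) = of_nat (card (strict_labelings \<pi> N))"
  shows "Lambda_s \<pi> = p"
  unfolding Lambda_s_def using assms
  by (intro the_equality) (auto intro: poly_eqI_positive_nats)

theorem proposition4p13:
  fixes n :: nat and \<pi> :: "nat set set"
  assumes "noncrossing_partition n \<pi>"
  shows "(Lambda \<pi> :: 'k :: field_char_0 poly) =
    smult ((-1) ^ card \<pi>) (pcompose (Lambda_s \<pi>) [:0, -1:])"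
proof -
  interpret finite_forest "nesting_less \<pi>" \<pi>
    using assms by (rule nesting_forest)
  obtain s :: "'k poly" where
    strict: "\<And>N. poly s (of_nat N) = of_nat (card (strict_labelings \<pi> N))" and
    weak: "\<And>N. (-1) ^ card \<pi> * poly s (- of_nat N) = of_nat (card (weak_labelings \<pi> N))"
    using forest_reciprocity [OF order_refl]
    unfolding weak_labelings_eq_gap_labelings strict_labelings_eq_gap_labelings by blast
  have "Lambda_s \<pi> = s"
    by (rule Lambda_s_eqI) (rule strict)
  moreover have "Lambda \<pi> = smult ((-1) ^ card \<pi>) (pcompose s [:0, -1:])"
    by (rule Lambda_eqI) (simp add: poly_pcompose weak)
  ultimately show ?thesis by simp
qed

end
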